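(* Let $A \in \mathbb{C}^{m \times n}$ and $W \in \mathbb{C}^{n \times m}$. Then the set $A\{1'\}$ is nonempty if and only if $r(AW)=r(WA)=r(A)$. If $A\{1'\} \neq \emptyset$, then $$A\{1'\}=\{(AW)^{(1)}A(WA)^{(1)}+Y-(AW)^{(1)}AWYWA(WA)^{(1)} \mid Y\in \mathbb{C}^{m \times n} \},$$ where $(AW)^{(1)}$ and $(WA)^{(1)}$ are fixed inner inverses of $AW$ and $WA$.
   Context: $r(\cdot)$ denotes rank. For $A \in \mathbb{C}^{m \times n}$, $W \in \mathbb{C}^{n \times m}$, the set $A\{1'\}$ of weighted inner inverses of $A$ (depending on $W$) consists of all $X \in \mathbb{C}^{m \times n}$ such that $AWXWA=A$. For a complex matrix $M$, $M^{(1)}$ denotes an inner inverse of $M$, i.e. a matrix with $MM^{(1)}M=M$. *)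

theory Defs
  imports "HOL-Analysis.Analysis"
begin

text \<open>A matrix with \<open>m\<close> rows and \<open>n\<close> columns has type \<^typ>\<open>complex ^ 'n ^ 'm\<close>: the row index is
  the outer one.\<close>

definition inner_inverse :: "complex ^ 'n ^ 'm \<Rightarrow> complex ^ 'm ^ 'n \<Rightarrow> bool"
  where "inner_inverse M G \<longleftrightarrow> M ** G ** M = M"

text \<open>The set \<open>A{1'}\<close>, with its dependence on \<open>W\<close> made explicit.\<close>

definition weighted_inner_inverses ::
    "complex ^ 'm ^ 'n \<Rightarrow> complex ^ 'n ^ 'm \<Rightarrow> (complex ^ 'n ^ 'm) set"
  where "weighted_inner_inverses W A = {X. A ** W ** X ** W ** A = A}"

end

theory Submission
  imports Defs
begin

text \<open>Equality of the ranks means exactly that \<open>A = A W U\<close> and \<open>A = V W A\<close> for some \<open>U\<close>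
  and \<open>V\<close>, and then \<open>X = U G V\<close> with \<open>A G A = A\<close> satisfies \<open>A W X W A = A\<close>. If such an \<open>X\<close>
  exists, all inner inverses \<open>P\<close> of \<open>A W\<close> and \<open>Q\<close> of \<open>W A\<close> satisfy \<open>A W P A = A = A Q W A\<close>, so
  every matrix of the given form is a solution; conversely, a solution \<open>X\<close> is recovered from the
  parameter \<open>Y = X\<close>.\<close>

lemma matrix_add_rdistrib: "(A + B) ** C = A ** C + B ** C"
  by (vector matrix_matrix_mult_def sum.distrib[symmetric] field_simps)

lemma matrix_diff_ldistrib: "A ** (B - C) = A ** B - A ** C"
  for A :: "'a::ring_1 ^ 'n ^ 'm"
  by (vector matrix_matrix_mult_def sum_subtractf[symmetric] right_diff_distrib)

lemma matrix_diff_rdistrib: "(A - B) ** C = A ** C - B ** C"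
  for A :: "'a::ring_1 ^ 'n ^ 'm"
  by (vector matrix_matrix_mult_def sum_subtractf[symmetric] left_diff_distrib)

lemma matrix_vector_mult_axis: "A *v axis j 1 = column j A"
  for A :: "'a::field ^ 'n ^ 'm"
  by (simp add: vec_eq_iff matrix_vector_mult_def column_def axis_def if_distrib cong: if_cong)

lemma range_matrix_vector_mult:
  fixes A :: "'a::field ^ 'n ^ 'm"
  shows "range ((*v) A) = vec.span (columns A)"
proof
  show "range ((*v) A) \<subseteq> vec.span (columns A)"
    unfolding matrix_mult_sum
    by (auto simp: columns_def intro: vec.span_sum vec.span_scale vec.span_base)
  have "columns A \<subseteq> range ((*v) A)"
    by (auto simp: columns_def simp flip: matrix_vector_mult_axis)
  then show "vec.span (columns A) \<subseteq> range ((*v) A)"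
    by (intro vec.span_minimal vec.subspace_image vec.subspace_UNIV)
qed

text \<open>Since \<open>rank\<close> unfolds to the dimension of the row space, this is the half of
  "row rank equals column rank" that needs an argument; transposition gives the other half.\<close>

lemma rank_le_dim_columns:
  fixes A :: "'a::field ^ 'n ^ 'm"
  shows "rank A \<le> vec.dim (columns A)"
proof -
  obtain B where B: "vec.independent B" "columns A \<subseteq> vec.span B" "card B = vec.dim (columns A)"
    using vec.basis_exists[of "columns A"] by metis
  have fin: "finite B"
    using B(1) by (rule vec.finiteI_independent)
  have "\<forall>j. \<exists>c. column j A = (\<Sum>b\<in>B. c b *s b)"
    using B(2) by (auto simp: vec.span_finite[OF fin] columns_def)
  then obtain c where c: "\<And>j. column j A = (\<Sum>b\<in>B. c j b *s b)"
    by metis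
  \<comment> \<open>Read row-wise, the same identity expresses all rows by the \<open>card B\<close> coefficient vectors.\<close>
  have "row i A = (\<Sum>b\<in>B. b $ i *s (\<chi> j. c j b))" for i
  proof -
    have "A $ i $ j = (\<Sum>b\<in>B. b $ i * c j b)" for j
      using arg_cong[OF c[of j], of "\<lambda>v. v $ i"] by (simp add: column_def mult.commute)
    then show ?thesis
      by (simp add: vec_eq_iff row_def)
  qed
  then have "rows A \<subseteq> vec.span ((\<lambda>b. \<chi> j. c j b) ` B)"
    by (auto simp: rows_def intro: vec.span_sum vec.span_scale vec.span_base)
  then have "rank A \<le> card ((\<lambda>b. \<chi> j. c j b) ` B)"
    unfolding row_rank_def_gen by (rule vec.dim_le_card) (simp add: fin)
  \<comment> \<open>Distinct basis vectors may share a coefficient vector, so the image of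
    \<open>B\<close> can be smaller than \<open>B\<close>.\<close>
  also have "\<dots> \<le> vec.dim (columns A)"
    using card_image_le[OF fin] B(3) by metis
  finally show ?thesis .
qed

lemma rank_transpose_field:
  fixes A :: "'a::field ^ 'n ^ 'm"
  shows "rank (transpose A) = rank A"
  using rank_le_dim_columns[of A] rank_le_dim_columns[of "transpose A"]
  by (simp add: row_rank_def_gen)

lemma rank_eq_dim_range:
  fixes A :: "'a::field ^ 'n ^ 'm"
  shows "rank A = vec.dim (range ((*v) A))"
  using rank_transpose_field[of A] by (simp add: row_rank_def_gen range_matrix_vector_mult)

lemma range_matrix_mult_subset: "range ((*v) (A ** B)) \<subseteq> range ((*v) A)"
  for A :: "'a::field ^ 'n ^ 'm"
  by (auto simp flip: matrix_vector_mul_assoc)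

lemma rank_matrix_mult_le_left:
  fixes A :: "'a::field ^ 'n ^ 'm"
  shows "rank (A ** B) \<le> rank A"
  unfolding rank_eq_dim_range by (intro vec.dim_subset range_matrix_mult_subset)

lemma rank_matrix_mult_le_right:
  fixes A :: "'a::field ^ 'n ^ 'm"
  shows "rank (A ** B) \<le> rank B"
  by (metis matrix_transpose_mul rank_matrix_mult_le_left rank_transpose_field)

text \<open>The column space of \<open>A ** B\<close> lies in that of \<open>A\<close>; equal
  dimension forces equality. So each column of \<open>A\<close> has a preimage under
  \<open>A ** B\<close>, and these preimages form the columns of \<open>U\<close>.\<close>

lemma right_factor_if_rank_eq:
  fixes A :: "'a::field ^ 'n ^ 'm" and B :: "'a ^ 'p ^ 'n"
  assumes "rank (A ** B) = rank A"
  obtains U where "A = A ** B ** U"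
proof -
  have "range ((*v) (A ** B)) = range ((*v) A)"
    using assms
    by (intro vec.subspace_dim_equal vec.subspace_image vec.subspace_UNIV range_matrix_mult_subset)
       (simp add: rank_eq_dim_range)
  then have "\<forall>j. \<exists>u. A *v axis j 1 = (A ** B) *v u"
    by (metis rangeE rangeI)
  then obtain u where u: "\<And>j. A *v axis j 1 = (A ** B) *v u j"
    by metis
  have "A $ i $ j = (A ** B ** (\<chi> i j. u j $ i)) $ i $ j" for i j
    using arg_cong[OF u[of j], of "\<lambda>v. v $ i"]
    unfolding matrix_vector_mult_axis
    by (simp add: column_def matrix_vector_mult_def matrix_matrix_mult_def)
  then show thesis
    by (intro that[of "\<chi> i j. u j $ i"]) (simp add: vec_eq_iff)
qed

lemma left_factor_if_rank_eq:
  fixes A :: "'a::field ^ 'n ^ 'm" and B :: "'a ^ 'm ^ 'p"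
  assumes "rank (B ** A) = rank A"
  obtains V where "A = V ** B ** A"
proof -
  have "rank (transpose A ** transpose B) = rank (transpose A)"
    using assms by (simp add: rank_transpose_field flip: matrix_transpose_mul)
  then obtain U where "transpose A = transpose A ** transpose B ** U"
    by (rule right_factor_if_rank_eq)
  then have "A = transpose U ** B ** A"
    by (metis matrix_mul_assoc matrix_transpose_mul transpose_transpose)
  then show thesis
    by (rule that)
qed

text \<open>A linear map has a linear right inverse on its range; the matrix of such a map serves as
  \<open>G\<close>.\<close>

lemma inner_inverse_exists:
  obtains G where "inner_inverse A G"
proof -
  obtain g where g: "Vector_Spaces.linear (*s) (*s) g" "\<And>x. A *v g (A *v x) = A *v x"
    using vec.linear_exists_right_inverse_on[OF matrix_vector_mul_linear_gen vec.subspace_UNIV, of A]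
    by auto
  then have "A ** matrix g ** A = A"
    by (simp add: matrix_eq matrix_works flip: matrix_vector_mul_assoc)
  then show thesis
    using that by (simp add: inner_inverse_def)
qed

lemma rank_eq_if_weighted_inner_inverse:
  assumes "X \<in> weighted_inner_inverses W A"
  shows "rank (A ** W) = rank A" and "rank (W ** A) = rank A"
proof -
  \<comment> \<open>Two bracketings of one equation: \<open>A\<close> factors through
    \<open>A ** W\<close> on the left and through \<open>W ** A\<close> on the right, which bounds
    its rank by each of theirs.\<close>
  have X: "A = A ** W ** (X ** W ** A)" "A = A ** W ** X ** (W ** A)"
    using assms by (simp_all add: weighted_inner_inverses_def matrix_mul_assoc)
  show "rank (A ** W) = rank A"
    using X(1) by (metis antisym rank_matrix_mult_le_left)
  show "rank (W ** A) = rank A"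
    using X(2) by (metis antisym rank_matrix_mult_le_right)
qed

lemma weighted_inner_inverse_exists_if_rank_eq:
  assumes "rank (A ** W) = rank A" and "rank (W ** A) = rank A"
  shows "weighted_inner_inverses W A \<noteq> {}"
proof -
  obtain U where U: "A = A ** W ** U"
    using assms(1) by (rule right_factor_if_rank_eq)
  obtain V where V: "A = V ** W ** A"
    using assms(2) by (rule left_factor_if_rank_eq)
  obtain G where G: "A ** G ** A = A"
    using inner_inverse_exists[of A] by (auto simp: inner_inverse_def)
  have "A ** W ** (U ** G ** V) ** W ** A = (A ** W ** U) ** G ** (V ** W ** A)"
    by (simp only: matrix_mul_assoc)
  also have "\<dots> = A"
    using U V G by simp
  finally show ?thesis
    by (auto simp: weighted_inner_inverses_def)
qed

text \<open>The formula has the affine shape of a linear equation's solution set: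
  \<open>P ** A ** Q\<close> is a particular solution, and the terms in \<open>Y\<close> run through
  the solutions \<open>Z\<close> of \<open>A ** W ** Z ** W ** A = 0\<close>.\<close>

lemma weighted_inner_inverses_eq:
  assumes X0: "X0 \<in> weighted_inner_inverses W A"
    and P: "inner_inverse (A ** W) P" and Q: "inner_inverse (W ** A) Q"
  shows "weighted_inner_inverses W A =
    {P ** A ** Q + Y - P ** A ** W ** Y ** W ** A ** Q | Y. True}" (is "_ = ?S")
proof
  show "weighted_inner_inverses W A \<subseteq> ?S"
  proof
    fix X assume "X \<in> weighted_inner_inverses W A"
    then have X: "A ** W ** X ** W ** A = A"
      by (simp add: weighted_inner_inverses_def)
    have "P ** A ** W ** X ** W ** A ** Q = P ** (A ** W ** X ** W ** A) ** Q"
      by (simp only: matrix_mul_assoc)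
    then have "X = P ** A ** Q + X - P ** A ** W ** X ** W ** A ** Q"
      by (simp add: X)
    then show "X \<in> ?S"
      by blast
  qed
  have X: "A ** W ** X0 ** W ** A = A"
    using X0 by (simp add: weighted_inner_inverses_def)
  have PA: "A ** W ** P ** A = A"
  proof -
    \<comment> \<open>Expanding the last \<open>A\<close> by the equation for \<open>X0\<close>
      creates the pattern that \<open>P\<close> collapses.\<close>
    have "A ** W ** P ** A = (A ** W ** P ** (A ** W)) ** X0 ** W ** A"
      by (metis X matrix_mul_assoc)
    then show ?thesis
      using P X by (simp add: inner_inverse_def)
  qed
  have AQ: "A ** Q ** W ** A = A"
  proof -
    \<comment> \<open>Mirror image: here the first \<open>A\<close> is expanded, so that
      \<open>Q\<close> collapses the bracket.\<close>
    have "A ** W ** X0 ** (W ** A ** Q ** (W ** A)) = (A ** W ** X0 ** W ** A) ** Q ** W ** A"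
      by (simp only: matrix_mul_assoc)
    then show ?thesis
      using Q X by (simp add: inner_inverse_def) (metis matrix_mul_assoc)
  qed
  show "?S \<subseteq> weighted_inner_inverses W A"
  proof clarify
    fix Y
    have "A ** W ** (P ** A ** Q) ** W ** A = (A ** W ** P ** A) ** Q ** W ** A"
      by (simp only: matrix_mul_assoc)
    then have 1: "A ** W ** (P ** A ** Q) ** W ** A = A"
      by (simp only: PA AQ)
    have "A ** W ** (P ** A ** W ** Y ** W ** A ** Q) ** W ** A
        = (A ** W ** P ** A) ** W ** Y ** W ** (A ** Q ** W ** A)"
      by (simp only: matrix_mul_assoc)
    then have 2: "A ** W ** (P ** A ** W ** Y ** W ** A ** Q) ** W ** A = A ** W ** Y ** W ** A"
      by (simp only: PA AQ)
    \<comment> \<open>By linearity fact 1 contributes \<open>A\<close>, while by fact 2 the two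
      terms containing \<open>Y\<close> cancel.\<close>
    have "A ** W ** (P ** A ** Q + Y - P ** A ** W ** Y ** W ** A ** Q) ** W ** A
        = A ** W ** (P ** A ** Q) ** W ** A + A ** W ** Y ** W ** A
          - A ** W ** (P ** A ** W ** Y ** W ** A ** Q) ** W ** A"
      by (simp only: matrix_add_ldistrib matrix_add_rdistrib matrix_diff_ldistrib matrix_diff_rdistrib)
    then show "P ** A ** Q + Y - P ** A ** W ** Y ** W ** A ** Q \<in> weighted_inner_inverses W A"
      by (simp add: 1 2 weighted_inner_inverses_def)
  qed
qed

theorem theorem2p3:
  fixes A :: "complex ^ 'n ^ 'm" and W :: "complex ^ 'm ^ 'n"
  shows "(weighted_inner_inverses W A \<noteq> {} \<longleftrightarrow>
            rank (A ** W) = rank (W ** A) \<and> rank (W ** A) = rank A)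
       \<and> (weighted_inner_inverses W A \<noteq> {} \<longrightarrow>
            (\<forall>P Q. inner_inverse (A ** W) P \<and> inner_inverse (W ** A) Q \<longrightarrow>
               weighted_inner_inverses W A =
                 {P ** A ** Q + Y - P ** A ** W ** Y ** W ** A ** Q | Y :: complex ^ 'n ^ 'm. True}))"
proof (intro conjI impI iffI allI)
  assume "weighted_inner_inverses W A \<noteq> {}"
  then obtain X where X: "X \<in> weighted_inner_inverses W A"
    by blast
  show "rank (A ** W) = rank (W ** A)" and "rank (W ** A) = rank A"
    using rank_eq_if_weighted_inner_inverse[OF X] by simp_all
  show "weighted_inner_inverses W A =
      {P ** A ** Q + Y - P ** A ** W ** Y ** W ** A ** Q | Y :: complex ^ 'n ^ 'm. True}"
    if "inner_inverse (A ** W) P \<and> inner_inverse (W ** A) Q" for P Q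
    using weighted_inner_inverses_eq[OF X] that by blast
next
  assume "rank (A ** W) = rank (W ** A) \<and> rank (W ** A) = rank A"
  then show "weighted_inner_inverses W A \<noteq> {}"
    by (simp add: weighted_inner_inverse_exists_if_rank_eq)
qed

end
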